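(* The cyclic-to-random transposition shuffle on $n$ cards has mixing time $\tau_{\rm mix}=\tau_{\rm mix}(n)=\Omega(n\log n)$ as $n\to\infty$. More precisely, for any nonzero complex root $\zeta$ of the equation $e^z-z-1=0$, the mixing time satisfies, as $n\to\infty$, $$\tau_{\rm mix}(n)\ \ge\ \frac{n\log n}{|\zeta+1|\,(1+o(1))}.$$
   Context: Let $[n]=\{0,1,\dots,n-1\}$ and let $S_n$ be the symmetric group on $[n]$; a permutation is viewed as an arrangement of $n$ cards in $n$ locations labelled by $[n]$. Let $\{R_t\}_{t\ge 1}$ be i.i.d. uniform on $[n]$. The cyclic-to-random (transposition) shuffle is the process $\{\sigma^*_t\}_{t\ge 0}$ on $S_n$ with a fixed initial permutation $\sigma^*_0$, where for $t\ge1$ the permutation $\sigma^*_t$ is obtained from $\sigma^*_{t-1}$ by transposing the cards at locations $L_t$ and $R_t$, with $L_t = t \bmod n$ (nothing is moved if $L_t=R_t$). Let $\mu^*_t$ be the distribution of $\sigma^*_t$, let $\mathcal{U}$ be the uniform distribution on $S_n$, and let $\Vert\cdot\Vert_{\rm TV}$ denote total variation distance (normalized to take values in $[0,1]$ for differences of probability measures). The mixing time is $$\tau_{\rm mix}=\max_{\sigma^*_0}\min\Bigl\{t:\Vert\mu^*_t-\mathcal{U}\Vert_{\rm TV}\le \tfrac{1}{2e}\Bigr\}.$$ *)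

theory Defs
  imports "HOL-Probability.Probability" "HOL-Combinatorics.Permutations"
    "HOL-Library.Landau_Symbols"
begin

text \<open>
  The symmetric group on \<open>[n] = {0, \<dots>, n - 1}\<close> is \<open>{\<sigma>. \<sigma> permutes {..<n}}\<close>; the arrangement
  \<open>\<sigma>\<close> has card \<open>\<sigma> x\<close> at location \<open>x\<close>, so exchanging the cards at locations \<open>l\<close> and \<open>r\<close> yields
  \<open>\<sigma> \<circ> transpose l r\<close>.
\<close>

definition sym_group :: "nat \<Rightarrow> (nat \<Rightarrow> nat) set" where
  "sym_group n = {\<sigma>. \<sigma> permutes {..<n}}"

primrec ctr_state :: "nat \<Rightarrow> (nat \<Rightarrow> nat) \<Rightarrow> (nat \<Rightarrow> nat) \<Rightarrow> nat \<Rightarrow> (nat \<Rightarrow> nat)" where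
  "ctr_state n \<sigma>\<^sub>0 R 0 = \<sigma>\<^sub>0"
| "ctr_state n \<sigma>\<^sub>0 R (Suc t) = ctr_state n \<sigma>\<^sub>0 R t \<circ> Transposition.transpose (Suc t mod n) (R (Suc t))"

text \<open>
  The state at time \<open>t\<close> depends only on \<open>R 1, \<dots>, R t\<close>, so its law is the image of the joint
  law of these independent uniform variables; the default value \<open>0\<close> of the product outside
  \<open>{1..t}\<close> is never read.
\<close>

definition ctr_law :: "nat \<Rightarrow> (nat \<Rightarrow> nat) \<Rightarrow> nat \<Rightarrow> (nat \<Rightarrow> nat) pmf" where
  "ctr_law n \<sigma>\<^sub>0 t =
     map_pmf (\<lambda>R. ctr_state n \<sigma>\<^sub>0 R t) (Pi_pmf {1..t} 0 (\<lambda>_. pmf_of_set {..<n}))"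

definition tv_dist :: "'a pmf \<Rightarrow> 'a pmf \<Rightarrow> real" where
  "tv_dist p q = (SUP A. \<bar>measure_pmf.prob p A - measure_pmf.prob q A\<bar>)"

text \<open>
  For \<open>n \<ge> 1\<close> the shuffle converges to uniform from every start, so the minimum below is taken
  over a nonempty set. The value at \<open>n = 0\<close> is irrelevant.
\<close>

definition mixing_time :: "nat \<Rightarrow> nat" where
  "mixing_time n =
     (MAX \<sigma>\<^sub>0 \<in> sym_group n.
        LEAST t. tv_dist (ctr_law n \<sigma>\<^sub>0 t) (pmf_of_set (sym_group n)) \<le> 1 / (2 * exp 1))"

end

theory Submission
  imports Defs "HOL-Complex_Analysis.Complex_Analysis" "HOL-Real_Asymp.Real_Asymp"
begin

text \<open>
  Wilson's method with an exact eigenfunction. Let \<open>k\<close> be the number of steps the cursor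
  still needs to reach a card. A step lowers \<open>k\<close> by one, except that the card jumps to
  \<open>k = n - 1\<close> when \<open>R\<close> hits it and to a uniform value when the cursor hits it. Hence
  \<open>\<beta> ^ k - 1\<close> is an eigenfunction of the motion of a single card, with eigenvalue
  \<open>\<mu> = (1 - 1/n) / \<beta>\<close>, as soon as \<open>\<beta> = 1 + z/n\<close> with \<open>(1 + z/n) ^ n = 1 + z\<close>; by Hurwitz's
  theorem such \<open>z\<close> exist arbitrarily close to every root \<open>\<zeta>\<close> of \<open>exp \<zeta> = \<zeta> + 1\<close>.

  Weighting card \<open>c\<close> by the conjugate of its initial value yields a statistic whose mean at
  time \<open>t\<close> has modulus at least \<open>n |\<mu>| ^ t\<close>, where \<open>|\<mu>| ^ (- n) \<longlonglongrightarrow> e |\<zeta> + 1|\<close>, and which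
  is centred under the uniform distribution. One step moves at most two cards, so it changes
  the statistic boundedly; by orthogonality of the increments, the variance is \<open>O(n)\<close> both
  along the shuffle and under the uniform distribution. Chebyshev's inequality separates the two
  laws up to time about \<open>n ln n / (2 (1 + ln |\<zeta> + 1|))\<close>. Nonzero roots satisfy
  \<open>|\<zeta> + 1| \<ge> 2 pi\<close>, so this time exceeds \<open>n ln n / |\<zeta> + 1|\<close>.
\<close>

section \<open>Roots of the limiting equation\<close>

lemma times_cos_less_sin:
  fixes y :: real
  assumes "0 < y" "y < pi"
  shows "y * cos y < sin y"
proof -
  have "(\<lambda>x. sin x - x * cos x) 0 < (\<lambda>x. sin x - x * cos x) y"
  proof (rule DERIV_pos_imp_increasing_open[OF \<open>0 < y\<close>])
    fix x assume x: "0 < x" "x < y"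
    have "((\<lambda>x. sin x - x * cos x) has_real_derivative x * sin x) (at x)"
      by (auto intro!: derivative_eq_intros)
    moreover have "x * sin x > 0"
      using x assms by (simp add: sin_gt_zero)
    ultimately show "\<exists>d. ((\<lambda>x. sin x - x * cos x) has_real_derivative d) (at x) \<and> 0 < d"
      by blast
  qed (auto intro!: continuous_intros)
  then show ?thesis by simp
qed

text \<open>Write the root as x + iy with 0 < y < 2 pi. The imaginary part forces sin y > 0, hence y
  < pi. Then y cos y < sin y forces x < 0, and exp x * sin y < sin y <= y contradicts the imaginary
  part.\<close>

lemma exp_eq_plus_one_Im_ge:
  fixes \<zeta> :: complex
  assumes "exp \<zeta> = \<zeta> + 1" "Im \<zeta> > 0"
  shows "Im \<zeta> \<ge> 2 * pi"
proof (rule ccontr)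
  define x y where "x = Re \<zeta>" and "y = Im \<zeta>"
  assume "\<not> ?thesis"
  then have y: "0 < y" "y < 2 * pi" using assms by (auto simp: y_def)
  have re: "exp x * cos y = x + 1" and im: "exp x * sin y = y"
    using arg_cong[OF assms(1), of Re] arg_cong[OF assms(1), of Im]
    by (auto simp: Re_exp Im_exp x_def y_def)
  have "sin y > 0"
    using im y by (metis exp_gt_zero zero_less_mult_pos)
  then have ypi: "y < pi"
    using sin_le_zero[of y] y by force
  have "exp x * sin y > exp x * (y * cos y)"
    using times_cos_less_sin[OF y(1) ypi] by simp
  then have "y > y * (x + 1)"
    using im re by (simp add: mult.left_commute)
  then have "x < 0"
    using y by (simp add: algebra_simps zero_less_mult_iff mult_less_0_iff)
  then have "exp x * sin y < 1 * sin y"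
    using \<open>sin y > 0\<close> by (intro mult_strict_right_mono) auto
  then show False
    using im sin_x_le_x[of y] y by simp
qed

text \<open>Convexity of exp leaves 0 as the only real root, and conjugation moves every other root
  to the upper half-plane. The rational bound 6 stands in for 2 pi and is just what the comparison
  of 1 + ln (s + 1/4) with s / 2 requires later.\<close>

lemma exp_eq_plus_one_norm_gt:
  fixes \<zeta> :: complex
  assumes "exp \<zeta> = \<zeta> + 1" "\<zeta> \<noteq> 0"
  shows "cmod (\<zeta> + 1) > 6"
proof -
  have "Im \<zeta> \<noteq> 0"
  proof
    assume 0: "Im \<zeta> = 0"
    have "exp (Re \<zeta>) = Re \<zeta> + 1"
      using arg_cong[OF assms(1), of Re] 0 by (simp add: Re_exp)
    \<comment> \<open>The point w = exp (Re \<zeta>) satisfies ln w = w - 1, which happens only at w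
      = 1.\<close>
    then have "exp (Re \<zeta>) = 1"
      by (intro ln_eq_minus_one exp_gt_zero) (metis add_diff_cancel_right' ln_exp)
    then show False using 0 assms(2) by (simp add: complex_eq_iff)
  qed
  moreover have "exp (cnj \<zeta>) = cnj \<zeta> + 1"
    using arg_cong[OF assms(1), of cnj] by (simp add: exp_cnj)
  ultimately have "\<bar>Im \<zeta>\<bar> \<ge> 2 * pi"
    using exp_eq_plus_one_Im_ge[of \<zeta>] exp_eq_plus_one_Im_ge[of "cnj \<zeta>"] assms by force
  moreover have "\<bar>Im \<zeta>\<bar> \<le> cmod (\<zeta> + 1)"
    using abs_Im_le_cmod[of "\<zeta> + 1"] by simp
  ultimately show ?thesis using pi_gt3 by linarith
qed

text \<open>The imaginary part of the equation gives x = ln (y / sin y); substituting this into the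
  real part leaves \<open>h y = 0\<close>, solved by the intermediate value theorem. At
  \<open>a\<close> the cotangent is 1, at \<open>b\<close> it is 0. The unconditional growth claim
  needs one such root.\<close>

lemma exp_eq_plus_one_exists: "\<exists>\<zeta>::complex. \<zeta> \<noteq> 0 \<and> exp \<zeta> = \<zeta> + 1"
proof -
  define h :: "real \<Rightarrow> real" where "h = (\<lambda>y. y * cos y / sin y - 1 - ln (y / sin y))"
  define a b :: real where "a = pi/4 + 2 * pi" and "b = pi/2 + 2 * pi"
  have sin: "sin y > 0" if "a \<le> y" "y \<le> b" for y
    using that sin_gt_zero[of "y - 2 * pi"] pi_gt_zero unfolding a_def b_def
    by (simp add: sin_diff)
  have "a > 0" using pi_gt_zero by (simp add: a_def)
  have "\<exists>y\<ge>a. y \<le> b \<and> h y = 0"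
  proof (rule IVT2')
    have "sin b = 1" "cos b = 0"
      unfolding b_def by (simp_all only: sin_periodic cos_periodic sin_pi_half cos_pi_half)
    then have "h b = - 1 - ln b"
      by (simp add: h_def)
    moreover have "b > 1" using pi_gt3 by (simp add: b_def)
    ultimately show "h b \<le> 0" using ln_gt_zero[of b] by linarith
    have sc: "sin a = sqrt 2 / 2" "cos a = sqrt 2 / 2"
      unfolding a_def by (simp_all only: sin_periodic cos_periodic sin_45 cos_45)
    moreover have "a / (sqrt 2 / 2) = a * sqrt 2"
      by (simp add: field_simps)
    ultimately have "h a = a - 1 - ln (a * sqrt 2)"
      unfolding h_def sc by simp
    \<comment> \<open>Bounding ln by its tangent at 4 gives ln (a sqrt 2) <= a / 4 + 1, so
      \<open>h a\<close> is at least 3 a / 4 - 2, positive for a > 6.\<close>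
    moreover have "ln (a * sqrt 2) = ln (a / 4) + ln (4 * sqrt 2)"
      using \<open>a > 0\<close> by (simp flip: ln_mult_pos)
    moreover have "ln (a / 4) \<le> a / 4 - 1"
      using \<open>a > 0\<close> by (intro ln_le_minus_one) auto
    moreover have "ln (4 * sqrt 2 :: real) \<le> 2"
    proof -
      have "sqrt 2 \<le> (3/2 :: real)" by (rule real_le_lsqrt) (auto simp: power2_eq_square)
      then have "4 * sqrt 2 \<le> ((5/2)\<^sup>2 :: real)" by (simp add: power2_eq_square)
      also have "\<dots> \<le> (exp 1)\<^sup>2"
        using exp_lower_Taylor_quadratic[of 1] by (intro power_mono) auto
      also have "\<dots> = exp 2" by (simp flip: exp_double)
      finally show ?thesis using ln_mono[of "4 * sqrt 2" "exp 2"] by simp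
    qed
    moreover have "a > 6" using pi_gt3 by (simp add: a_def)
    ultimately show "0 \<le> h a" by linarith
    show "a \<le> b" by (simp add: a_def b_def)
    have "\<forall>y\<in>{a..b}. sin y \<noteq> 0 \<and> y / sin y \<noteq> 0"
      using sin \<open>a > 0\<close> by fastforce
    then show "continuous_on {a..b} h" unfolding h_def
      by (intro continuous_intros) auto
  qed
  then obtain y where y: "a \<le> y" "y \<le> b" "h y = 0" by blast
  have s: "sin y > 0" and "y > 0" using sin[OF y(1,2)] \<open>a > 0\<close> y by auto
  define \<zeta> where "\<zeta> = Complex (ln (y / sin y)) y"
  have "exp (ln (y / sin y)) = y / sin y" using s \<open>y > 0\<close> by simp
  then have "exp \<zeta> = \<zeta> + 1"
    using y(3) s by (auto simp: complex_eq_iff \<zeta>_def Re_exp Im_exp h_def field_simps)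
  moreover have "\<zeta> \<noteq> 0" using \<open>y > 0\<close> by (auto simp: \<zeta>_def complex_eq_iff)
  ultimately show ?thesis by blast
qed

section \<open>Roots of the equation for finite n\<close>

lemma norm_power_diff_le:
  fixes a b :: "'a :: {real_normed_algebra_1, comm_ring_1}"
  assumes "norm a \<le> c" "norm b \<le> c" "1 \<le> c"
  shows "norm (a ^ n - b ^ n) \<le> n * c ^ n * norm (a - b)"
proof (induction n)
  case (Suc n)
  have "a ^ Suc n - b ^ Suc n = a * (a ^ n - b ^ n) + (a - b) * b ^ n"
    by (simp add: algebra_simps)
  also have "norm \<dots> \<le> norm a * norm (a ^ n - b ^ n) + norm (a - b) * norm (b ^ n)"
    by (intro order.trans[OF norm_triangle_ineq] add_mono norm_mult_ineq)
  also have "\<dots> \<le> c * (n * c ^ n * norm (a - b)) + norm (a - b) * c ^ Suc n"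
  proof (intro add_mono mult_mono Suc assms order.refl)
    have "norm (b ^ n) \<le> norm b ^ n" by (rule norm_power_ineq)
    also have "\<dots> \<le> c ^ n" using assms by (intro power_mono) auto
    also have "\<dots> \<le> c ^ Suc n" using assms by (intro power_increasing) auto
    finally show "norm (b ^ n) \<le> c ^ Suc n" .
  qed (use assms in auto)
  also have "\<dots> = Suc n * c ^ Suc n * norm (a - b)"
    by (simp add: algebra_simps)
  finally show ?case .
qed auto

text \<open>With w = z / n both sides are n-th powers, of 1 + w and exp w, and both bases have norm
  at most exp |w|. The bases differ by a second-order Taylor remainder, and passing to n-th powers
  costs a factor n exp |z|. The explicit bound gives uniform convergence on compact sets.\<close>

lemma norm_one_plus_div_power_minus_exp_le:
  fixes z :: complex
  assumes "n > 0"
  shows "cmod ((1 + z / of_nat n) ^ n - exp z) \<le> exp (2 * cmod z) * (cmod z)\<^sup>2 / n"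
proof -
  define w where "w = z / of_nat n"
  define c where "c = exp (cmod w)"
  have nw: "cmod w = cmod z / n" by (simp add: w_def norm_divide)
  have ez: "exp z = exp w ^ n"
    using assms by (simp add: w_def flip: exp_of_nat_mult)
  have "cmod (1 + w) \<le> c"
    using norm_triangle_ineq[of 1 w] exp_ge_add_one_self[of "cmod w"] unfolding c_def norm_one by linarith
  moreover have "cmod (exp w) \<le> c"
    by (simp add: c_def complex_Re_le_cmod)
  ultimately have "cmod ((1 + w) ^ n - exp w ^ n) \<le> n * c ^ n * cmod ((1 + w) - exp w)"
    by (intro norm_power_diff_le) (auto simp: c_def)
  also have "c ^ n = exp (cmod z)"
    using assms by (simp add: c_def nw flip: exp_of_nat_mult)
  also have "cmod ((1 + w) - exp w) \<le> exp (cmod z) * (cmod z / n)\<^sup>2"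
  proof -
    have "cmod (exp w - (\<Sum>i\<le>1. w ^ i / fact i)) \<le> exp \<bar>Re w\<bar> * cmod w ^ Suc 1 / fact 1"
      by (rule Taylor_exp)
    moreover have "exp \<bar>Re w\<bar> \<le> exp (cmod z)"
    proof -
      have "\<bar>Re w\<bar> \<le> cmod w" by (rule abs_Re_le_cmod)
      also have "\<dots> \<le> cmod z" using assms by (simp add: nw divide_le_eq mult_le_cancel_left1)
      finally show ?thesis by simp
    qed
    then have "exp \<bar>Re w\<bar> * cmod w ^ 2 \<le> exp (cmod z) * (cmod z / n)\<^sup>2"
      by (intro mult_mono) (auto simp: nw)
    ultimately show ?thesis by (simp add: norm_minus_commute numeral_2_eq_2)
  qed
  also have "n * exp (cmod z) * (exp (cmod z) * (cmod z / n)\<^sup>2) = exp (2 * cmod z) * (cmod z)\<^sup>2 / n"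
    unfolding exp_double using assms by (simp add: field_simps power2_eq_square)
  finally show ?thesis by (simp add: w_def ez mult_left_mono)
qed

text \<open>If the ball contained no root for infinitely many n, Hurwitz's theorem along that
  subsequence would leave the limit \<open>G\<close> without zeros in the ball, although
  \<open>\<zeta>\<close> is one.\<close>

lemma eventually_root_near:
  fixes \<zeta> :: complex
  assumes "exp \<zeta> = \<zeta> + 1" "r > 0"
  shows "\<forall>\<^sub>F n in sequentially. \<exists>z\<in>ball \<zeta> r. (1 + z / of_nat n) ^ n = 1 + z"
proof (rule ccontr)
  define F where "F = (\<lambda>n (z::complex). (1 + z / of_nat n) ^ n - (1 + z))"
  define G where "G = (\<lambda>z::complex. exp z - (1 + z))"
  assume "\<not> ?thesis"
  then obtain \<rho> :: "nat \<Rightarrow> nat" where \<rho>: "strict_mono \<rho>" "\<And>n z. z \<in> ball \<zeta> r \<Longrightarrow> F (\<rho> n) z \<noteq> 0"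
    using not_eventually_sequentiallyD by (fastforce simp: F_def)
  have ul: "uniform_limit K (\<lambda>n. F (\<rho> n)) G sequentially" if K: "compact K" for K
  proof -
    obtain M where M: "\<And>z. z \<in> K \<Longrightarrow> cmod z \<le> M" "M \<ge> 0"
      using compact_imp_bounded[OF K] by (metis bounded_iff norm_ge_zero order.trans linear)
    have "uniform_limit K F G sequentially"
    proof (rule uniform_limitI)
      fix e :: real assume "e > 0"
      have "(\<lambda>n. exp (2 * M) * M\<^sup>2 / real n) \<longlonglongrightarrow> 0"
        by (rule lim_const_over_n)
      then have "\<forall>\<^sub>F n in sequentially. exp (2 * M) * M\<^sup>2 / real n < e"
        using \<open>e > 0\<close> order_tendstoD(2) by blast
      then show "\<forall>\<^sub>F n in sequentially. \<forall>x\<in>K. dist (F n x) (G x) < e"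
        using eventually_gt_at_top[of 0]
      proof eventually_elim
        case (elim n)
        show ?case
        proof
          fix z assume "z \<in> K"
          have "dist (F n z) (G z) = cmod ((1 + z / of_nat n) ^ n - exp z)"
            by (simp add: F_def G_def dist_norm)
          also have "\<dots> \<le> exp (2 * cmod z) * (cmod z)\<^sup>2 / n"
            by (rule norm_one_plus_div_power_minus_exp_le) fact
          also have "\<dots> \<le> exp (2 * M) * M\<^sup>2 / n"
            using M(1)[OF \<open>z \<in> K\<close>] by (intro divide_right_mono mult_mono power_mono) auto
          finally show "dist (F n z) (G z) < e" using elim by simp
        qed
      qed
    qed
    then show ?thesis
      by (rule filterlim_compose) (use \<rho> filterlim_subseq in blast)
  qed
  have "G \<zeta> \<noteq> 0"
  proof (rule Hurwitz_no_zeros[of "ball \<zeta> r" "\<lambda>n. F (\<rho> n)" G])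
    show "\<not> G constant_on ball \<zeta> r"
    proof
      assume "G constant_on ball \<zeta> r"
      then obtain c where c: "\<And>z. z \<in> ball \<zeta> r \<Longrightarrow> G z = c" by (auto simp: constant_on_def)
      have "exp z = 1" if "z \<in> ball \<zeta> r" for z
      proof -
        have "(G has_field_derivative exp z - 1) (at z)"
          unfolding G_def by (auto intro!: derivative_eq_intros)
        moreover have "(G has_field_derivative 0) (at z)"
          using c that
          by (intro has_field_derivative_transform_within_open[of "\<lambda>_. c" 0 z "ball \<zeta> r" G])
            (auto intro!: derivative_eq_intros)
        ultimately show ?thesis using DERIV_unique by fastforce
      qed
      \<comment> \<open>The two values of exp differ by the factor exp (r / 2), so they cannot both
        be 1.\<close>
      from this[of \<zeta>] this[of "\<zeta> + of_real (r/2)"] assms(2) show False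
        by (auto simp: dist_norm exp_add exp_of_real simp del: of_real_divide)
    qed
  qed (use assms(2) \<rho>(2) ul in \<open>auto simp: F_def G_def intro!: holomorphic_intros\<close>)
  then show False using assms(1) by (simp add: G_def)
qed

section \<open>Convergence of the shuffle to uniform\<close>

lemma finite_sym_group [simp]: "finite (sym_group n)"
  by (simp add: sym_group_def finite_permutations)

lemma id_in_sym_group [simp]: "id \<in> sym_group n"
  by (simp add: sym_group_def permutes_id)

lemma sym_group_nonempty [simp]: "sym_group n \<noteq> {}"
  using id_in_sym_group by blast

lemma comp_transpose_in_sym_group:
  "\<lbrakk>\<sigma> \<in> sym_group n; l < n; r < n\<rbrakk> \<Longrightarrow> \<sigma> \<circ> Transposition.transpose l r \<in> sym_group n"
  by (auto simp: sym_group_def intro!: permutes_compose permutes_swap_id)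

lemma bij_betw_comp_transpose:
  assumes "l < n" "r < n"
  shows "bij_betw (\<lambda>\<sigma>. \<sigma> \<circ> Transposition.transpose l r) (sym_group n) (sym_group n)"
  by (rule bij_betwI[where g = "\<lambda>\<sigma>. \<sigma> \<circ> Transposition.transpose l r"])
    (use assms in \<open>auto simp: comp_transpose_in_sym_group comp_assoc\<close>)

section \<open>The shuffle as a time-periodic Markov chain\<close>

definition ctr_kernel :: "nat \<Rightarrow> nat \<Rightarrow> (nat \<Rightarrow> nat) \<Rightarrow> (nat \<Rightarrow> nat) pmf" where
  "ctr_kernel n t \<sigma> = map_pmf (\<lambda>r. \<sigma> \<circ> Transposition.transpose (t mod n) r) (pmf_of_set {..<n})"

lemma ctr_state_cong:
  "(\<And>i. i \<in> {1..t} \<Longrightarrow> R i = R' i) \<Longrightarrow> ctr_state n \<sigma> R t = ctr_state n \<sigma> R' t"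
  by (induction t) auto

lemma ctr_law_0 [simp]: "ctr_law n \<sigma> 0 = return_pmf \<sigma>"
  by (simp add: ctr_law_def)

text \<open>The state at time t never reads coordinate t + 1 of the product, so that coordinate can
  be drawn after it; this turns the law on the product space into a Markov step.\<close>

lemma ctr_law_Suc: "ctr_law n \<sigma> (Suc t) = ctr_law n \<sigma> t \<bind> ctr_kernel n (Suc t)"
proof -
  have upd: "ctr_state n \<sigma> (f(Suc t := y)) t = ctr_state n \<sigma> f t" for f y
    by (rule ctr_state_cong) auto
  have "{1..Suc t} = insert (Suc t) {1..t}" by auto
  then have "ctr_law n \<sigma> (Suc t) =
      pmf_of_set {..<n} \<bind> (\<lambda>y. Pi_pmf {1..t} 0 (\<lambda>_. pmf_of_set {..<n}) \<bind>
        (\<lambda>f. return_pmf (ctr_state n \<sigma> f t \<circ> Transposition.transpose (Suc t mod n) y)))"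
    by (simp add: ctr_law_def Pi_pmf_insert' map_bind_pmf upd)
  also have "\<dots> = Pi_pmf {1..t} 0 (\<lambda>_. pmf_of_set {..<n}) \<bind> (\<lambda>f. pmf_of_set {..<n} \<bind>
        (\<lambda>y. return_pmf (ctr_state n \<sigma> f t \<circ> Transposition.transpose (Suc t mod n) y)))"
    by (rule bind_commute_pmf)
  also have "\<dots> = ctr_law n \<sigma> t \<bind> ctr_kernel n (Suc t)"
    unfolding ctr_law_def bind_map_pmf ctr_kernel_def by (simp add: map_pmf_def)
  finally show ?thesis .
qed

lemma ctr_kernel_periodic: "ctr_kernel n (m * n + t) = ctr_kernel n t"
  by (simp add: ctr_kernel_def fun_eq_iff)

text \<open>The chain restarts only after whole cycles, when the cursor is back at its initial
  position.\<close>

lemma ctr_law_add: "ctr_law n \<sigma> (m * n + t) = ctr_law n \<sigma> (m * n) \<bind> (\<lambda>\<tau>. ctr_law n \<tau> t)"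
proof (induction t)
  case (Suc t)
  show ?case
    using ctr_kernel_periodic[of n m "Suc t"] by (simp add: ctr_law_Suc Suc bind_assoc_pmf)
qed (simp add: bind_return_pmf')

lemma set_ctr_kernel:
  assumes "n > 0"
  shows "set_pmf (ctr_kernel n t \<sigma>) = (\<lambda>r. \<sigma> \<circ> Transposition.transpose (t mod n) r) ` {..<n}"
  using assms by (simp add: ctr_kernel_def set_pmf_of_set lessThan_empty_iff)

lemma set_ctr_law_subset:
  assumes "n > 0" "\<sigma> \<in> sym_group n"
  shows "set_pmf (ctr_law n \<sigma> t) \<subseteq> sym_group n"
  by (induction t)
    (use assms in \<open>auto simp: ctr_law_Suc set_ctr_kernel comp_transpose_in_sym_group\<close>)

text \<open>In one cycle the cursor visits each location once, and \<open>R\<close> can fetch there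
  the card that \<open>\<tau>\<close> prescribes. That card is not among those already placed, since
  \<open>\<tau>\<close> is injective, so earlier placements survive.\<close>

lemma set_ctr_law_full_cycle:
  assumes n: "n > 0" and \<sigma>: "\<sigma> \<in> sym_group n"
  shows "set_pmf (ctr_law n \<sigma> n) = sym_group n"
proof (intro equalityI subsetI)
  fix \<tau> assume \<tau>: "\<tau> \<in> sym_group n"
  have "\<exists>\<rho>\<in>set_pmf (ctr_law n \<sigma> t). \<forall>i\<in>{1..t}. \<rho> (i mod n) = \<tau> (i mod n)" if "t \<le> n" for t
    using that
  proof (induction t)
    case (Suc t)
    then obtain \<rho> where \<rho>: "\<rho> \<in> set_pmf (ctr_law n \<sigma> t)" "\<And>i. i \<in> {1..t} \<Longrightarrow> \<rho> (i mod n) = \<tau> (i mod n)"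
      by auto
    define l where "l = Suc t mod n"
    have perm: "\<rho> permutes {..<n}" "\<tau> permutes {..<n}"
      using \<rho>(1) set_ctr_law_subset[OF n \<sigma>] \<tau> by (auto simp: sym_group_def)
    define r where "r = inv \<rho> (\<tau> l)"
    have "l < n" using n by (simp add: l_def)
    then have r: "r < n"
      using permutes_in_image[OF perm(2), of l] permutes_in_image[OF permutes_inv[OF perm(1)], of "\<tau> l"]
      by (simp add: r_def)
    have \<rho>r: "\<rho> r = \<tau> l" using permutes_inverses(1)[OF perm(1)] by (simp add: r_def)
    have "(\<rho> \<circ> Transposition.transpose l r) (i mod n) = \<tau> (i mod n)" if "i \<in> {1..Suc t}" for i
    proof (cases "i = Suc t")
      case True
      then show ?thesis using \<rho>r by (simp add: l_def)
    next
      case False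
      then have i: "i \<in> {1..t}" using that by auto
      have "i mod n = i" using i Suc.prems by auto
      \<comment> \<open>The cursor starts at location 1 and wraps to location 0 only in the last
        step of the cycle.\<close>
      moreover have "l \<noteq> i" using i Suc.prems by (cases "Suc t = n") (auto simp: l_def)
      ultimately have "i mod n \<noteq> l" by simp
      moreover from this have "i mod n \<noteq> r"
        using \<rho>r \<rho>(2)[OF i] permutes_inj[OF perm(2)] by (metis injD)
      ultimately show ?thesis using \<rho>(2)[OF i] by (simp add: Transposition.transpose_def)
    qed
    moreover have "\<rho> \<circ> Transposition.transpose l r \<in> set_pmf (ctr_law n \<sigma> (Suc t))"
      using \<rho>(1) r n by (auto simp: ctr_law_Suc set_ctr_kernel l_def)
    ultimately show ?case by blast
  qed auto
  then obtain \<rho> where \<rho>: "\<rho> \<in> set_pmf (ctr_law n \<sigma> n)" "\<And>i. i \<in> {1..n} \<Longrightarrow> \<rho> (i mod n) = \<tau> (i mod n)"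
    by blast
  have "\<rho> x = \<tau> x" for x
  proof (cases "x < n")
    case True
    then show ?thesis using \<rho>(2)[of x] \<rho>(2)[of n] n by (cases "x = 0") auto
  next
    case False
    then show ?thesis
      using \<rho>(1) \<tau> set_ctr_law_subset[OF n \<sigma>, of n]
      by (auto simp: sym_group_def permutes_def)
  qed
  then have "\<rho> = \<tau>" by auto
  with \<rho>(1) show "\<tau> \<in> set_pmf (ctr_law n \<sigma> n)" by simp
qed (use set_ctr_law_subset assms in blast)

lemma uniform_bind_ctr_law:
  assumes n: "n > 0"
  shows "pmf_of_set (sym_group n) \<bind> (\<lambda>\<sigma>. ctr_law n \<sigma> t) = pmf_of_set (sym_group n)"
proof (induction t)
  case 0
  then show ?case by (simp add: bind_return_pmf')
next
  case (Suc t)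
  have "pmf_of_set (sym_group n) \<bind> (\<lambda>\<sigma>. ctr_law n \<sigma> (Suc t)) =
      pmf_of_set (sym_group n) \<bind> ctr_kernel n (Suc t)"
    by (simp add: ctr_law_Suc Suc flip: bind_assoc_pmf)
  also have "\<dots> = pmf_of_set {..<n} \<bind> (\<lambda>r. map_pmf
      (\<lambda>\<sigma>. \<sigma> \<circ> Transposition.transpose (Suc t mod n) r) (pmf_of_set (sym_group n)))"
    unfolding ctr_kernel_def map_pmf_def by (rule bind_commute_pmf)
  also have "\<dots> = pmf_of_set {..<n} \<bind> (\<lambda>r. pmf_of_set (sym_group n))"
    by (intro bind_pmf_cong refl map_pmf_of_set_bij_betw bij_betw_comp_transpose)
      (use n in \<open>auto simp: set_pmf_of_set lessThan_empty_iff\<close>)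
  finally show ?case by simp
qed

section \<open>Total variation distance and convergence\<close>

lemma expectation_sym_group:
  fixes h :: "(nat \<Rightarrow> nat) \<Rightarrow> 'b :: {banach, second_countable_topology}"
  assumes "set_pmf p \<subseteq> sym_group n"
  shows "measure_pmf.expectation p h = (\<Sum>\<sigma>\<in>sym_group n. pmf p \<sigma> *\<^sub>R h \<sigma>)"
  by (rule integral_measure_pmf) (use assms in auto)

lemma prob_sym_group:
  assumes "set_pmf p \<subseteq> sym_group n"
  shows "measure_pmf.prob p A = (\<Sum>\<sigma>\<in>sym_group n. pmf p \<sigma> * indicator A \<sigma>)"
  using expectation_sym_group[OF assms, of "indicator A :: _ \<Rightarrow> real"] by simp

lemma tv_dist_le_L1:
  assumes "set_pmf p \<subseteq> sym_group n" "set_pmf q \<subseteq> sym_group n"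
  shows "tv_dist p q \<le> (\<Sum>\<sigma>\<in>sym_group n. \<bar>pmf p \<sigma> - pmf q \<sigma>\<bar>)"
  unfolding tv_dist_def
proof (rule cSUP_least)
  fix A
  have "\<bar>measure_pmf.prob p A - measure_pmf.prob q A\<bar> =
      \<bar>\<Sum>\<sigma>\<in>sym_group n. (pmf p \<sigma> - pmf q \<sigma>) * indicator A \<sigma>\<bar>"
    by (simp add: prob_sym_group[OF assms(1)] prob_sym_group[OF assms(2)] sum_subtractf left_diff_distrib)
  also have "\<dots> \<le> (\<Sum>\<sigma>\<in>sym_group n. \<bar>pmf p \<sigma> - pmf q \<sigma>\<bar>)"
    by (intro order.trans[OF sum_abs] sum_mono) (auto simp: indicator_def)
  finally show "\<bar>measure_pmf.prob p A - measure_pmf.prob q A\<bar> \<le> (\<Sum>\<sigma>\<in>sym_group n. \<bar>pmf p \<sigma> - pmf q \<sigma>\<bar>)" .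
qed simp

lemma tv_dist_ge: "\<bar>measure_pmf.prob p A - measure_pmf.prob q A\<bar> \<le> tv_dist p q"
  unfolding tv_dist_def
proof (rule cSUP_upper)
  have "\<bar>measure_pmf.prob p A - measure_pmf.prob q A\<bar> \<le> 1" for A
    using measure_pmf.prob_le_1[of p A] measure_pmf.prob_le_1[of q A]
      measure_nonneg[of p A] measure_nonneg[of q A] by linarith
  then show "bdd_above (range (\<lambda>A. \<bar>measure_pmf.prob p A - measure_pmf.prob q A\<bar>))"
    by (intro bdd_aboveI[of _ 1]) auto
qed simp

(* Doeblin minorization: every permutation is reachable from every other one in a full cycle. *)
lemma ctr_law_L1_contraction:
  assumes n: "n > 0"
  obtains c where "0 \<le> c" "c < 1"
    "\<And>\<sigma> m. \<sigma> \<in> sym_group n \<Longrightarrow>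
      (\<Sum>\<tau>\<in>sym_group n. \<bar>pmf (ctr_law n \<sigma> (Suc m * n)) \<tau> - pmf (pmf_of_set (sym_group n)) \<tau>\<bar>) \<le>
      c * (\<Sum>\<tau>\<in>sym_group n. \<bar>pmf (ctr_law n \<sigma> (m * n)) \<tau> - pmf (pmf_of_set (sym_group n)) \<tau>\<bar>)"
proof -
  let ?S = "sym_group n" and ?U = "pmf_of_set (sym_group n)"
  define Q where "Q = (\<lambda>\<sigma>. pmf (ctr_law n \<sigma> n))"
  define \<delta> where "\<delta> = Min ((\<lambda>(\<sigma>,\<tau>). Q \<sigma> \<tau>) ` (?S \<times> ?S))"
  have fin: "finite ((\<lambda>(\<sigma>,\<tau>). Q \<sigma> \<tau>) ` (?S \<times> ?S))" by simp
  have "\<delta> \<in> (\<lambda>(\<sigma>,\<tau>). Q \<sigma> \<tau>) ` (?S \<times> ?S)"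
    unfolding \<delta>_def by (rule Min_in[OF fin]) simp
  then have "\<delta> > 0"
    using set_ctr_law_full_cycle[OF n] by (fastforce simp: Q_def pmf_positive)
  have \<delta>_le: "\<delta> \<le> Q \<sigma> \<tau>" if "\<sigma> \<in> ?S" "\<tau> \<in> ?S" for \<sigma> \<tau>
    unfolding \<delta>_def by (rule Min_le[OF fin]) (use that in auto)
  have sum_Q: "(\<Sum>\<tau>\<in>?S. Q \<sigma> \<tau>) = 1" if "\<sigma> \<in> ?S" for \<sigma>
    unfolding Q_def by (rule sum_pmf_eq_1) (use set_ctr_law_subset[OF n that] in auto)
  \<comment> \<open>The mass left in each row of the one-cycle transition matrix after removing the
    common part \<open>\<delta>\<close> from every entry.\<close>
  define c where "c = 1 - card ?S * \<delta>"
  have row: "(\<Sum>\<tau>\<in>?S. Q \<sigma> \<tau> - \<delta>) = c" if "\<sigma> \<in> ?S" for \<sigma>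
    by (simp add: sum_subtractf sum_Q[OF that] c_def)
  show thesis
  proof
    have "0 \<le> (\<Sum>\<tau>\<in>?S. Q id \<tau> - \<delta>)" by (intro sum_nonneg) (use \<delta>_le in auto)
    then show "0 \<le> c" using row[of id] by simp
    show "c < 1" using \<open>\<delta> > 0\<close> by (simp add: c_def card_gt_0_iff)
  next
    fix \<sigma> m assume \<sigma>: "\<sigma> \<in> ?S"
    define f where "f = (\<lambda>\<tau>. pmf (ctr_law n \<sigma> (m * n)) \<tau> - pmf ?U \<tau>)"
    have sub: "set_pmf (ctr_law n \<sigma> k) \<subseteq> ?S" for k by (rule set_ctr_law_subset[OF n \<sigma>])
    have U: "set_pmf ?U = ?S" by (simp add: set_pmf_of_set)
    have "(\<Sum>\<rho>\<in>?S. pmf (ctr_law n \<sigma> (m * n)) \<rho>) = 1" "(\<Sum>\<rho>\<in>?S. pmf ?U \<rho>) = 1"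
      by (intro sum_pmf_eq_1 finite_sym_group sub, intro sum_pmf_eq_1, simp_all only: U finite_sym_group order.refl)
    then have f0: "(\<Sum>\<rho>\<in>?S. f \<rho>) = 0"
      unfolding f_def sum_subtractf by simp
    \<comment> \<open>The deviation \<open>f\<close> has total mass zero, so subtracting a constant
      from the matrix does not change its image.\<close>
    have step: "pmf (ctr_law n \<sigma> (Suc m * n)) \<tau> - pmf ?U \<tau> = (\<Sum>\<rho>\<in>?S. f \<rho> * (Q \<rho> \<tau> - \<delta>))" for \<tau>
    proof -
      have "pmf (ctr_law n \<sigma> (Suc m * n)) \<tau> = (\<Sum>\<rho>\<in>?S. pmf (ctr_law n \<sigma> (m * n)) \<rho> * Q \<rho> \<tau>)"
        using ctr_law_add[of n \<sigma> m n] expectation_sym_group[OF sub, where h = "\<lambda>\<rho>. Q \<rho> \<tau>"]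
        by (simp add: pmf_bind Q_def add.commute)
      moreover have "pmf ?U \<tau> = (\<Sum>\<rho>\<in>?S. pmf ?U \<rho> * Q \<rho> \<tau>)"
      proof -
        have "pmf ?U \<tau> = pmf (?U \<bind> (\<lambda>\<rho>. ctr_law n \<rho> n)) \<tau>"
          by (simp only: uniform_bind_ctr_law[OF n])
        also have "\<dots> = (\<Sum>\<rho>\<in>?S. pmf ?U \<rho> *\<^sub>R Q \<rho> \<tau>)"
          unfolding pmf_bind Q_def by (rule expectation_sym_group) (simp only: U order.refl)
        finally show ?thesis by (simp only: real_scaleR_def)
      qed
      moreover have "(\<Sum>\<rho>\<in>?S. f \<rho> * \<delta>) = 0"
        using f0 by (simp flip: sum_distrib_right)
      ultimately show ?thesis
        by (simp only: f_def sum_subtractf right_diff_distrib left_diff_distrib diff_zero)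
    qed
    have "(\<Sum>\<tau>\<in>?S. \<bar>pmf (ctr_law n \<sigma> (Suc m * n)) \<tau> - pmf ?U \<tau>\<bar>) \<le>
        (\<Sum>\<tau>\<in>?S. \<Sum>\<rho>\<in>?S. \<bar>f \<rho>\<bar> * (Q \<rho> \<tau> - \<delta>))"
      unfolding step by (intro sum_mono order.trans[OF sum_abs]) (auto simp: abs_mult \<delta>_le)
    also have "\<dots> = (\<Sum>\<rho>\<in>?S. \<Sum>\<tau>\<in>?S. \<bar>f \<rho>\<bar> * (Q \<rho> \<tau> - \<delta>))"
      by (rule sum.swap)
    also have "\<dots> = (\<Sum>\<rho>\<in>?S. \<bar>f \<rho>\<bar> * c)"
      by (intro sum.cong refl) (simp add: row flip: sum_distrib_left)
    finally show "(\<Sum>\<tau>\<in>?S. \<bar>pmf (ctr_law n \<sigma> (Suc m * n)) \<tau> - pmf ?U \<tau>\<bar>) \<le>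
        c * (\<Sum>\<tau>\<in>?S. \<bar>pmf (ctr_law n \<sigma> (m * n)) \<tau> - pmf ?U \<tau>\<bar>)"
      by (simp only: f_def mult.commute[of c] sum_distrib_right)
  qed
qed

text \<open>The L1 deviation contracts geometrically once per cycle. This guarantees that the
  \<open>LEAST\<close> in \<open>mixing_time\<close> is attained; otherwise distance from uniform at
  early times would not bound it.\<close>

lemma tv_dist_ctr_law_eventually_le:
  assumes n: "n > 0" and \<sigma>: "\<sigma> \<in> sym_group n" and "e > 0"
  shows "\<exists>t. tv_dist (ctr_law n \<sigma> t) (pmf_of_set (sym_group n)) \<le> e"
proof -
  let ?d = "\<lambda>m. \<Sum>\<tau>\<in>sym_group n. \<bar>pmf (ctr_law n \<sigma> (m * n)) \<tau> - pmf (pmf_of_set (sym_group n)) \<tau>\<bar>"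
  obtain c where c: "0 \<le> c" "c < 1" "\<And>m. ?d (Suc m) \<le> c * ?d m"
    by (rule ctr_law_L1_contraction[OF n]) (use \<sigma> in blast)
  have "?d m \<le> c ^ m * ?d 0" for m
  proof (induction m)
    case (Suc m)
    have "?d (Suc m) \<le> c * ?d m" by (rule c)
    also have "\<dots> \<le> c * (c ^ m * ?d 0)" by (intro mult_left_mono Suc c)
    finally show ?case by (simp add: mult.assoc)
  qed auto
  moreover have "(\<lambda>m. c ^ m * ?d 0) \<longlonglongrightarrow> 0"
    using LIMSEQ_realpow_zero[of c] c by (auto intro!: tendsto_mult_left_zero)
  then have "\<forall>\<^sub>F m in sequentially. c ^ m * ?d 0 < e"
    using \<open>e > 0\<close> order_tendstoD(2) by blast
  then obtain m where "c ^ m * ?d 0 < e"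
    by (auto simp: eventually_sequentially)
  moreover have "tv_dist (ctr_law n \<sigma> (m * n)) (pmf_of_set (sym_group n)) \<le> ?d m"
    by (intro tv_dist_le_L1 set_ctr_law_subset n \<sigma>) (simp add: set_pmf_of_set)
  ultimately show ?thesis by (meson less_imp_le order.trans)
qed

lemma mixing_time_ge:
  assumes n: "n > 0" and \<sigma>: "\<sigma> \<in> sym_group n"
    and far: "\<And>t. real t < T \<Longrightarrow> tv_dist (ctr_law n \<sigma> t) (pmf_of_set (sym_group n)) > 1 / (2 * exp 1)"
  shows "real (mixing_time n) \<ge> T"
proof -
  let ?P = "\<lambda>\<sigma> t. tv_dist (ctr_law n \<sigma> t) (pmf_of_set (sym_group n)) \<le> 1 / (2 * exp 1)"
  have "?P \<sigma> (LEAST t. ?P \<sigma> t)"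
    by (rule LeastI_ex, rule tv_dist_ctr_law_eventually_le[OF n \<sigma>]) simp
  then have "T \<le> real (LEAST t. ?P \<sigma> t)"
    using far[of "LEAST t. ?P \<sigma> t"] unfolding not_less[symmetric] by iprover
  also have "(LEAST t. ?P \<sigma> t) \<le> mixing_time n"
    unfolding mixing_time_def
    by (rule Max_ge[OF finite_imageI[OF finite_sym_group] imageI[OF \<sigma>]])
  finally show ?thesis by simp
qed

lemma expectation_ctr_law_Suc:
  fixes h :: "(nat \<Rightarrow> nat) \<Rightarrow> 'b :: {banach, second_countable_topology}"
  assumes "n > 0" "\<sigma> \<in> sym_group n"
  shows "measure_pmf.expectation (ctr_law n \<sigma> (Suc t)) h =
    measure_pmf.expectation (ctr_law n \<sigma> t)
      (\<lambda>\<tau>. (\<Sum>r<n. h (\<tau> \<circ> Transposition.transpose (Suc t mod n) r)) /\<^sub>R real n)"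
proof -
  have "measure_pmf.expectation (ctr_kernel n (Suc t) \<tau>) h =
      (\<Sum>r<n. h (\<tau> \<circ> Transposition.transpose (Suc t mod n) r)) /\<^sub>R real n" for \<tau>
    unfolding ctr_kernel_def integral_map_pmf
    by (subst integral_measure_pmf[of "{..<n}"])
      (use assms in \<open>auto simp: set_pmf_of_set lessThan_empty_iff scaleR_sum_right divide_inverse\<close>)
  moreover have "measure_pmf.expectation (ctr_law n \<sigma> (Suc t)) h =
      (\<Sum>\<tau>\<in>sym_group n. pmf (ctr_law n \<sigma> t) \<tau> *\<^sub>R measure_pmf.expectation (ctr_kernel n (Suc t) \<tau>) h)"
    unfolding ctr_law_Suc
    by (intro pmf_expectation_bind set_ctr_law_subset assms finite_sym_group) (simp add: set_ctr_kernel assms(1))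
  ultimately show ?thesis
    by (simp only: expectation_sym_group[OF set_ctr_law_subset[OF assms]])
qed

section \<open>The eigenfunction and its moments\<close>

text \<open>The mean square distance to the mean is at most that to any other point
  \<open>c\<close>. Taking for \<open>c\<close> the value before the swap, a bound on the jump
  suffices to control the variance of a step.\<close>

lemma sum_norm_sq_le_mean_plus_deviation:
  fixes X :: "nat \<Rightarrow> 'a :: real_inner"
  assumes "n > 0" "(\<Sum>r<n. X r) = real n *\<^sub>R m" "\<And>r. r < n \<Longrightarrow> norm (X r - c) \<le> D"
  shows "(\<Sum>r<n. (norm (X r))\<^sup>2) \<le> n * ((norm m)\<^sup>2 + D\<^sup>2)"
proof -
  have "(\<Sum>r<n. (norm (X r))\<^sup>2) = (\<Sum>r<n. (norm (X r - c))\<^sup>2 + 2 * inner c (X r) - (norm c)\<^sup>2)"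
    by (intro sum.cong refl) (simp add: power2_norm_eq_inner inner_diff inner_commute)
  also have "\<dots> = (\<Sum>r<n. (norm (X r - c))\<^sup>2) + 2 * inner c (\<Sum>r<n. X r) - n * (norm c)\<^sup>2"
    by (simp add: sum.distrib sum_subtractf inner_sum_right sum_distrib_left)
  also have "\<dots> = (\<Sum>r<n. (norm (X r - c))\<^sup>2) + n * (2 * inner c m - (norm c)\<^sup>2)"
    using assms(2) by (simp add: algebra_simps)
  also have "\<dots> \<le> (\<Sum>r<n. D\<^sup>2) + n * (norm m)\<^sup>2"
  proof (intro add_mono sum_mono mult_left_mono power_mono)
    have "0 \<le> (norm (c - m))\<^sup>2" by simp
    then show "2 * inner c m - (norm c)\<^sup>2 \<le> (norm m)\<^sup>2"
      by (simp add: power2_norm_eq_inner inner_diff inner_commute)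
  qed (use assms(3) in auto)
  finally show ?thesis by (simp add: algebra_simps)
qed

text \<open>The condition on \<open>d\<close> makes \<open>K\<close> an upper bound for the fixed
  point of the recursion. The starting time \<open>t\<close> is kept free so that the bound applies
  both from time 0 and over one period.\<close>

lemma affine_recursion_le:
  fixes u :: "nat \<Rightarrow> real"
  assumes "\<And>t. u (Suc t) \<le> q * u t + d" "d \<le> (1 - q) * K" "0 \<le> q"
  shows "u (t + m) - K \<le> q ^ m * (u t - K)"
proof (induction m)
  case (Suc m)
  have "u (t + Suc m) - K \<le> q * (u (t + m) - K)"
    using assms(1)[of "t + m"] assms(2) by (simp add: algebra_simps)
  also have "\<dots> \<le> q * (q ^ m * (u t - K))"
    by (intro mult_left_mono Suc assms)
  finally show ?case by (simp add: mult.assoc)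
qed auto

text \<open>The bound 4 holds for z close to a nonzero root \<open>\<zeta>\<close>. It excludes z =
  0, gives |\<beta>| >= 1, and makes the initial value of the statistic of order n.\<close>

locale ctr_eigen =
  fixes n :: nat and z :: complex
  assumes n: "n > 1" and root: "(1 + z / of_nat n) ^ n = 1 + z" and large: "cmod (1 + z) \<ge> 4"
begin

definition \<beta> :: complex where "\<beta> = 1 + z / of_nat n"

definition \<mu> :: complex where "\<mu> = (1 - 1 / of_nat n) / \<beta>"

text \<open>Number of steps after time \<open>t + 1\<close> until the cursor \<open>L\<close> reaches location \<open>p\<close>.\<close>

definition wait :: "nat \<Rightarrow> nat \<Rightarrow> nat" where
  "wait t p = nat ((int p - int (Suc t)) mod int n)"

definition g :: "nat \<Rightarrow> nat \<Rightarrow> complex" where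
  "g t p = \<beta> ^ wait t p - 1"

definition S :: "(nat \<Rightarrow> complex) \<Rightarrow> nat \<Rightarrow> (nat \<Rightarrow> nat) \<Rightarrow> complex" where
  "S a t \<sigma> = (\<Sum>p<n. a (\<sigma> p) * g t p)"

lemma \<beta>_power: "\<beta> ^ n = 1 + z"
  using root by (simp add: \<beta>_def)

lemma norm_\<beta>_ge: "cmod \<beta> \<ge> 1"
proof (rule ccontr)
  assume "\<not> ?thesis"
  then have "cmod \<beta> ^ n \<le> 1" by (intro power_le_one) auto
  then show False using large by (simp add: \<beta>_power flip: norm_power)
qed

lemma \<beta>_nonzero: "\<beta> \<noteq> 0"
  using norm_\<beta>_ge by auto

lemma norm_\<mu>: "cmod \<mu> = (1 - 1 / n) / cmod \<beta>"
proof -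
  have "1 - 1 / of_nat n = complex_of_real (1 - 1 / n)" by simp
  then have "cmod (1 - 1 / of_nat n) = \<bar>1 - 1 / n\<bar>" by (metis norm_of_real)
  then show ?thesis using n by (simp add: \<mu>_def norm_divide)
qed

lemma norm_\<mu>_pos: "cmod \<mu> > 0"
  using n \<beta>_nonzero by (simp add: norm_\<mu>)

lemma norm_\<mu>_sq_le: "(cmod \<mu>)\<^sup>2 \<le> 1 - 1 / n"
proof -
  have "cmod \<mu> \<le> 1 - 1 / n"
    using n norm_\<beta>_ge by (simp add: norm_\<mu> divide_le_eq mult_le_cancel_left1)
  then have "(cmod \<mu>)\<^sup>2 \<le> (1 - 1 / n)\<^sup>2" by (intro power_mono) auto
  also have "\<dots> \<le> 1 - 1 / n"
    using n by (simp add: power2_eq_square mult_left_le_one_le)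
  finally show ?thesis .
qed

section \<open>Arithmetic of the waiting time\<close>

lemma wait_less: "wait t p < n"
  using n by (simp add: wait_def nat_less_iff)

lemma int_wait: "int (wait t p) = (int p - int (Suc t)) mod int n"
  using n by (simp add: wait_def)

lemma wait_periodic: "wait (t + n) p = wait t p"
proof -
  have "(int p - int (Suc (t + n))) mod int n = (int p - int (Suc t) - int n) mod int n"
    by (simp add: algebra_simps)
  also have "\<dots> = (int p - int (Suc t)) mod int n" by (rule minus_mod_self2)
  finally show ?thesis by (simp add: wait_def)
qed

text \<open>Recovering the location from its wait makes \<open>wait t\<close> injective, so sums
  over locations become sums over waits.\<close>

lemma location_of_wait: "p < n \<Longrightarrow> p = (wait t p + Suc t) mod n"
proof -
  assume "p < n"
  have "int ((wait t p + Suc t) mod n) = ((int p - int (Suc t)) mod int n + int (Suc t)) mod int n"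
    by (simp only: of_nat_mod of_nat_add int_wait)
  also have "\<dots> = int p" using \<open>p < n\<close> by (simp only: mod_add_left_eq) simp
  finally show ?thesis by simp
qed

lemma bij_betw_wait: "bij_betw (wait t) {..<n} {..<n}"
proof -
  have "inj_on (wait t) {..<n}"
    by (rule inj_onI) (metis lessThan_iff location_of_wait)
  moreover have "wait t ` {..<n} \<subseteq> {..<n}" using wait_less by auto
  ultimately show ?thesis
    by (simp add: bij_betw_def endo_inj_surj)
qed

lemma wait_cursor: "wait t (Suc t mod n) = 0"
proof -
  have "int (wait t (Suc t mod n)) = (int (Suc t) mod int n - int (Suc t)) mod int n"
    by (simp only: int_wait of_nat_mod)
  also have "\<dots> = 0" by (simp only: mod_diff_left_eq) simp
  finally show ?thesis by simp
qed

lemma wait_Suc: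
  assumes "p < n" "p \<noteq> Suc t mod n"
  shows "wait t p = Suc (wait (Suc t) p)"
proof -
  have pos: "wait t p > 0"
    using location_of_wait[OF assms(1), of t] assms(2) by (cases "wait t p") auto
  have "int (wait (Suc t) p) = ((int p - int (Suc t)) - 1) mod int n"
    by (simp add: int_wait algebra_simps)
  also have "\<dots> = (int (wait t p) - 1) mod int n"
    by (simp only: int_wait mod_diff_left_eq)
  also have "\<dots> = int (wait t p) - 1"
    using pos wait_less[of t p] by (intro mod_pos_pos_trivial) auto
  finally show ?thesis by simp
qed

lemma wait_Suc_cursor: "wait (Suc t) (Suc t mod n) = n - 1"
proof -
  have "int (wait (Suc t) (Suc t mod n)) = ((int (Suc t) mod int n - int (Suc t)) mod int n - 1) mod int n"
    by (simp add: int_wait of_nat_mod mod_diff_left_eq algebra_simps)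
  also have "\<dots> = (- 1) mod int n" by (simp only: mod_diff_left_eq) (simp add: mod_diff_left_eq)
  also have "\<dots> = int n - 1" using n by (simp add: zmod_minus1)
  finally show ?thesis using n by simp
qed

section \<open>The eigenfunction equation\<close>

lemma sum_wait: "(\<Sum>p<n. h (wait t p)) = (\<Sum>k<n. h k)"
  by (rule sum.reindex_bij_betw[OF bij_betw_wait])

text \<open>Since \<beta> - 1 = z / n, the geometric sum is n (\<beta> ^ n - 1) / z, and the
  equation for z makes this exactly n. Hence \<open>g\<close> has mean zero over the
  locations.\<close>

lemma sum_\<beta>_power: "(\<Sum>k<n. \<beta> ^ k) = of_nat n"
proof -
  have "z \<noteq> 0" using large by auto
  then have "\<beta> \<noteq> 1" using n by (simp add: \<beta>_def)
  then have "(\<Sum>k<n. \<beta> ^ k) = (\<beta> ^ n - 1) / (\<beta> - 1)" by (rule geometric_sum)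
  then show ?thesis using \<open>z \<noteq> 0\<close> n by (simp add: \<beta>_power) (simp add: \<beta>_def)
qed

lemma sum_g: "(\<Sum>p<n. g t p) = 0"
  unfolding g_def using sum_wait[of "\<lambda>k. \<beta> ^ k - 1" t]
  by (simp add: sum_subtractf sum_\<beta>_power)

text \<open>The card at the cursor moves to a uniform location, where \<open>g\<close> has mean
  zero; subtracting 1 in \<open>g\<close> makes this consistent with the eigenvalue
  relation.\<close>

lemma g_cursor: "g t (Suc t mod n) = 0"
  by (simp add: g_def wait_cursor)

lemma norm_g_le: "cmod (g t p) \<le> 1 + cmod (1 + z)"
proof -
  have "cmod (\<beta> ^ wait t p) \<le> cmod (\<beta> ^ n)"
    unfolding norm_power by (intro power_increasing norm_\<beta>_ge less_imp_le wait_less)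
  then show ?thesis
    using norm_triangle_ineq4[of "\<beta> ^ wait t p" 1] by (simp add: g_def \<beta>_power)
qed

text \<open>A card away from the cursor is hit with probability 1/n and then has wait n - 1. The
  powers of \<beta> match by the choice of \<mu>; the constant terms match exactly when \<beta> ^ n
  = 1 + n \<beta> - n, which is the equation for z.\<close>

lemma g_eigen:
  assumes "p < n" "p \<noteq> Suc t mod n"
  shows "(1 - 1 / of_nat n) * g (Suc t) p + g (Suc t) (Suc t mod n) / of_nat n = \<mu> * g t p"
proof -
  define w where "w = wait (Suc t) p"
  define N :: complex where "N = of_nat n"
  have N: "N \<noteq> 0" using n by (simp add: N_def)
  have "\<beta> * \<beta> ^ (n - 1) = 1 + z" using \<beta>_power n by (simp flip: power_Suc)
  moreover have "N * \<beta> - N = z" using N by (simp add: \<beta>_def N_def field_simps)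
  ultimately have "\<beta> * \<beta> ^ (n - 1) = 1 + N * \<beta> - N" by simp
  then have *: "\<beta> ^ (n - 1) = (1 + N * \<beta> - N) / \<beta>"
    using \<beta>_nonzero by (simp add: field_simps)
  show ?thesis
    unfolding g_def wait_Suc[OF assms] wait_Suc_cursor \<mu>_def * w_def[symmetric] N_def[symmetric]
    using \<beta>_nonzero N by (simp add: field_simps)
qed

lemma S_comp_transpose:
  assumes "l < n" "r < n"
  shows "S a t (\<sigma> \<circ> Transposition.transpose l r) =
    S a t \<sigma> + (a (\<sigma> r) - a (\<sigma> l)) * (g t l - g t r)"
proof (cases "l = r")
  case False
  have split: "(\<Sum>p<n. f p) = f l + (f r + (\<Sum>p\<in>{..<n} - {l} - {r}. f p))" for f :: "nat \<Rightarrow> complex"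
    using assms False by (simp add: sum.remove[of _ l] sum.remove[of _ r])
  have "(\<Sum>p\<in>{..<n} - {l} - {r}. a ((\<sigma> \<circ> Transposition.transpose l r) p) * g t p) =
      (\<Sum>p\<in>{..<n} - {l} - {r}. a (\<sigma> p) * g t p)"
    by (intro sum.cong refl) (auto simp: Transposition.transpose_def)
  then show ?thesis
    unfolding S_def split by (simp add: algebra_simps)
qed (simp add: transpose_same)

lemma sum_S_step:
  "(\<Sum>r<n. S a (Suc t) (\<sigma> \<circ> Transposition.transpose (Suc t mod n) r)) = of_nat n * (\<mu> * S a t \<sigma>)"
proof -
  define l where "l = Suc t mod n"
  define N :: complex where "N = of_nat n"
  have N: "N \<noteq> 0" using n by (simp add: N_def)
  have l: "l < n" using n by (simp add: l_def)
  let ?g = "g (Suc t)"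
  have "(\<Sum>r<n. S a (Suc t) (\<sigma> \<circ> Transposition.transpose l r)) =
      (\<Sum>r<n. S a (Suc t) \<sigma> + (a (\<sigma> r) * ?g l - a (\<sigma> r) * ?g r - a (\<sigma> l) * ?g l + a (\<sigma> l) * ?g r))"
    by (intro sum.cong refl) (simp add: S_comp_transpose l algebra_simps)
  also have "\<dots> = N * S a (Suc t) \<sigma> + ((\<Sum>r<n. a (\<sigma> r) * ?g l) - S a (Suc t) \<sigma> - N * (a (\<sigma> l) * ?g l))"
    using sum_g[of "Suc t"]
    by (simp add: sum.distrib sum_subtractf N_def S_def flip: sum_distrib_left)
  also have "\<dots> = (\<Sum>p<n. N * (a (\<sigma> p) * ((1 - 1 / N) * ?g p + ?g l / N))) - N * (a (\<sigma> l) * ?g l)"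
    using N by (simp add: S_def sum.distrib sum_subtractf sum_distrib_left algebra_simps)
  also have "\<dots> = (\<Sum>p<n. N * (a (\<sigma> p) * (\<mu> * g t p)))"
  proof -
    \<comment> \<open>At the cursor the left-hand side is \<open>N * (a (\<sigma> l) * ?g l)\<close>
      while \<open>g t l\<close> vanishes. This excess cancels the term subtracted in the previous
      line of the calculation.\<close>
    have eq: "N * (a (\<sigma> p) * ((1 - 1 / N) * ?g p + ?g l / N)) =
        N * (a (\<sigma> p) * (\<mu> * g t p)) + (if p = l then N * (a (\<sigma> l) * ?g l) else 0)" if "p < n" for p
    proof (cases "p = l")
      case True
      then show ?thesis using g_cursor[of t] N by (simp add: l_def[symmetric] field_simps)
    next
      case False
      then show ?thesis using g_eigen[OF that] by (simp add: l_def N_def)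
    qed
    have "(\<Sum>p<n. N * (a (\<sigma> p) * ((1 - 1 / N) * ?g p + ?g l / N))) =
        (\<Sum>p<n. N * (a (\<sigma> p) * (\<mu> * g t p)) + (if p = l then N * (a (\<sigma> l) * ?g l) else 0))"
      by (intro sum.cong refl eq) simp
    then show ?thesis
      using l by (simp add: sum.distrib)
  qed
  also have "\<dots> = N * (\<mu> * S a t \<sigma>)"
    by (simp add: S_def sum_distrib_left algebra_simps)
  finally show ?thesis by (simp add: l_def N_def)
qed

section \<open>Moments of the statistic and separation of the two laws\<close>

lemma expectation_S:
  assumes "\<sigma> \<in> sym_group n"
  shows "measure_pmf.expectation (ctr_law n \<sigma> t) (S a t) = \<mu> ^ t * S a 0 \<sigma>"
proof (induction t)
  case (Suc t)
  have "measure_pmf.expectation (ctr_law n \<sigma> (Suc t)) (S a (Suc t)) =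
      measure_pmf.expectation (ctr_law n \<sigma> t) (\<lambda>\<tau>. \<mu> * S a t \<tau>)"
    using n assms by (subst expectation_ctr_law_Suc) (auto simp: sum_S_step scaleR_conv_of_real)
  also have "\<dots> = \<mu> * measure_pmf.expectation (ctr_law n \<sigma> t) (S a t)"
    by simp
  finally show ?case by (simp add: Suc)
qed simp

text \<open>One constant serves for the card weights and for \<open>g\<close>, because the weights
  will be conjugates of values of \<open>g\<close>.\<close>

context
  fixes a :: "nat \<Rightarrow> complex" and B :: real
  assumes a: "\<And>c. cmod (a c) \<le> B" and B: "B = 1 + cmod (1 + z)"
begin

lemma norm_S_jump_le:
  assumes "l < n" "r < n"
  shows "cmod (S a t (\<sigma> \<circ> Transposition.transpose l r) - S a t \<sigma>) \<le> 4 * B\<^sup>2"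
proof -
  have "cmod (a (\<sigma> r) - a (\<sigma> l)) * cmod (g t l - g t r) \<le> (2 * B) * (2 * B)"
  proof (intro mult_mono)
    show "cmod (a (\<sigma> r) - a (\<sigma> l)) \<le> 2 * B"
      using norm_triangle_ineq4[of "a (\<sigma> r)" "a (\<sigma> l)"] a[of "\<sigma> r"] a[of "\<sigma> l"] by linarith
    show "cmod (g t l - g t r) \<le> 2 * B"
      using norm_triangle_ineq4[of "g t l" "g t r"] norm_g_le[of t l] norm_g_le[of t r] B by linarith
    show "0 \<le> 2 * B" using a[of 0] norm_ge_zero[of "a 0"] by linarith
  qed auto
  then show ?thesis using assms by (simp add: S_comp_transpose norm_mult power2_eq_square)
qed

lemma sum_norm_sq_S_step:
  "(\<Sum>r<n. (cmod (S a (Suc t) (\<sigma> \<circ> Transposition.transpose (Suc t mod n) r)))\<^sup>2) \<le>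
    n * ((cmod \<mu>)\<^sup>2 * (cmod (S a t \<sigma>))\<^sup>2 + (4 * B\<^sup>2)\<^sup>2)"
  using sum_norm_sq_le_mean_plus_deviation[of n
      "\<lambda>r. S a (Suc t) (\<sigma> \<circ> Transposition.transpose (Suc t mod n) r)" "\<mu> * S a t \<sigma>" "S a (Suc t) \<sigma>" "4 * B\<^sup>2"]
    n norm_S_jump_le sum_S_step
  by (simp add: norm_mult power_mult_distrib scaleR_conv_of_real)

text \<open>The fluctuation added per step is O(1) and the contraction gap is at least 1/n, so the
  accumulated variance is O(n).\<close>

lemma deviation_budget: "(4 * B\<^sup>2)\<^sup>2 \<le> (1 - (cmod \<mu>)\<^sup>2) * (16 * B ^ 4 * n)"
proof -
  have "1 / n * (16 * B ^ 4 * n) \<le> (1 - (cmod \<mu>)\<^sup>2) * (16 * B ^ 4 * n)"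
    using norm_\<mu>_sq_le by (intro mult_right_mono) auto
  then show ?thesis using n by (simp add: power_mult_distrib flip: power_mult)
qed

text \<open>The start is deterministic, so the second moment initially equals the squared mean, and
  both contract by |\<mu>|^2 per step. What remains above the squared mean is the accumulated
  fluctuation.\<close>

lemma second_moment_S_le:
  assumes "\<sigma> \<in> sym_group n"
  shows "measure_pmf.expectation (ctr_law n \<sigma> t) (\<lambda>\<tau>. (cmod (S a t \<tau>))\<^sup>2) \<le>
    (cmod (\<mu> ^ t * S a 0 \<sigma>))\<^sup>2 + 16 * B ^ 4 * n"
proof -
  define u where "u = (\<lambda>t. measure_pmf.expectation (ctr_law n \<sigma> t) (\<lambda>\<tau>. (cmod (S a t \<tau>))\<^sup>2))"
  have sub: "set_pmf (ctr_law n \<sigma> t) \<subseteq> sym_group n" for t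
    using n assms by (intro set_ctr_law_subset) auto
  have int: "integrable (measure_pmf (ctr_law n \<sigma> t)) f" for t and f :: "_ \<Rightarrow> real"
    by (intro integrable_measure_pmf_finite finite_subset[OF sub]) auto
  have rec: "u (Suc t) \<le> (cmod \<mu>)\<^sup>2 * u t + (4 * B\<^sup>2)\<^sup>2" for t
  proof -
    have "u (Suc t) \<le> measure_pmf.expectation (ctr_law n \<sigma> t)
        (\<lambda>\<tau>. (cmod \<mu>)\<^sup>2 * (cmod (S a t \<tau>))\<^sup>2 + (4 * B\<^sup>2)\<^sup>2)"
      unfolding u_def using n assms
      by (subst expectation_ctr_law_Suc, simp, simp, intro integral_mono int)
        (use sum_norm_sq_S_step in \<open>simp add: divide_simps mult.commute\<close>)
    also have "\<dots> = (cmod \<mu>)\<^sup>2 * u t + (4 * B\<^sup>2)\<^sup>2"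
      unfolding u_def by (subst Bochner_Integration.integral_add) (simp_all add: int)
    finally show ?thesis .
  qed
  have "u (0 + t) - 16 * B ^ 4 * n \<le> ((cmod \<mu>)\<^sup>2) ^ t * (u 0 - 16 * B ^ 4 * n)"
    by (rule affine_recursion_le[of u, OF rec deviation_budget]) simp
  also have "\<dots> \<le> ((cmod \<mu>)\<^sup>2) ^ t * u 0"
    using zero_le_power_eq[of B 4] by (intro mult_left_mono) auto
  also have "\<dots> = (cmod (\<mu> ^ t * S a 0 \<sigma>))\<^sup>2"
    by (simp add: u_def norm_mult norm_power power_mult_distrib flip: power_mult) (simp add: mult.commute)
  finally show ?thesis by (simp add: u_def)
qed

(* Stationarity and periodicity in t turn the one-step inequality into a bound on the stationary moment itself. *)
lemma uniform_second_moment_S_le: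
  "measure_pmf.expectation (pmf_of_set (sym_group n)) (\<lambda>\<tau>. (cmod (S a t \<tau>))\<^sup>2) \<le> 16 * B ^ 4 * n"
proof -
  let ?G = "sym_group n"
  define v where "v = (\<lambda>t. (\<Sum>\<tau>\<in>?G. (cmod (S a t \<tau>))\<^sup>2) / card ?G)"
  have cG: "card ?G > 0" by (simp add: card_gt_0_iff)
  have rec: "v (Suc t) \<le> (cmod \<mu>)\<^sup>2 * v t + (4 * B\<^sup>2)\<^sup>2" for t
  proof -
    let ?l = "Suc t mod n"
    have "n * (\<Sum>\<tau>\<in>?G. (cmod (S a (Suc t) \<tau>))\<^sup>2) =
        (\<Sum>r<n. \<Sum>\<tau>\<in>?G. (cmod (S a (Suc t) (\<tau> \<circ> Transposition.transpose ?l r)))\<^sup>2)"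
    proof -
      have "(\<Sum>\<tau>\<in>?G. (cmod (S a (Suc t) (\<tau> \<circ> Transposition.transpose ?l r)))\<^sup>2) =
          (\<Sum>\<tau>\<in>?G. (cmod (S a (Suc t) \<tau>))\<^sup>2)" if "r < n" for r
        using that n
        by (intro sum.reindex_bij_betw[where g = "\<lambda>\<tau>. (cmod (S a (Suc t) \<tau>))\<^sup>2", OF bij_betw_comp_transpose]) auto
      then show ?thesis by simp
    qed
    also have "\<dots> = (\<Sum>\<tau>\<in>?G. \<Sum>r<n. (cmod (S a (Suc t) (\<tau> \<circ> Transposition.transpose ?l r)))\<^sup>2)"
      by (rule sum.swap)
    also have "\<dots> \<le> (\<Sum>\<tau>\<in>?G. n * ((cmod \<mu>)\<^sup>2 * (cmod (S a t \<tau>))\<^sup>2 + (4 * B\<^sup>2)\<^sup>2))"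
      by (intro sum_mono sum_norm_sq_S_step)
    also have "\<dots> = n * ((cmod \<mu>)\<^sup>2 * (\<Sum>\<tau>\<in>?G. (cmod (S a t \<tau>))\<^sup>2) + card ?G * (4 * B\<^sup>2)\<^sup>2)"
      by (simp add: sum.distrib flip: sum_distrib_left)
    finally have "(\<Sum>\<tau>\<in>?G. (cmod (S a (Suc t) \<tau>))\<^sup>2) \<le>
        (cmod \<mu>)\<^sup>2 * (\<Sum>\<tau>\<in>?G. (cmod (S a t \<tau>))\<^sup>2) + card ?G * (4 * B\<^sup>2)\<^sup>2"
      using n by simp
    then show ?thesis
      using cG by (simp add: v_def field_simps)
  qed
  have "v (t + n) = v t"
    by (simp add: v_def S_def g_def wait_periodic)
  then have "v t - 16 * B ^ 4 * n \<le> ((cmod \<mu>)\<^sup>2) ^ n * (v t - 16 * B ^ 4 * n)"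
    using affine_recursion_le[of v, OF rec deviation_budget, of t n] by simp
  then have "(1 - ((cmod \<mu>)\<^sup>2) ^ n) * (v t - 16 * B ^ 4 * n) \<le> 0"
    by (simp add: algebra_simps)
  moreover have "((cmod \<mu>)\<^sup>2) ^ n < 1"
  proof -
    have "1 / real n > 0" using n by simp
    then have "(cmod \<mu>)\<^sup>2 < 1" using norm_\<mu>_sq_le by linarith
    then show ?thesis using n by (simp add: power_less_one_iff)
  qed
  ultimately have "v t \<le> 16 * B ^ 4 * n"
    by (simp add: mult_le_0_iff)
  then show ?thesis
    by (simp add: v_def integral_pmf_of_set)
qed

text \<open>The test set is the disc of radius |m| / 2, where m is the mean under the shuffle.
  Chebyshev's inequality bounds by 4 K / |m|^2 both the shuffle's mass inside and the uniform mass
  outside; with K = 16 B^4 n the two add up to the constant 128.\<close>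

lemma tv_dist_ge_moments:
  assumes "\<sigma> \<in> sym_group n" "S a 0 \<sigma> \<noteq> 0"
  shows "tv_dist (ctr_law n \<sigma> t) (pmf_of_set (sym_group n)) \<ge>
    1 - 128 * B ^ 4 * n / (cmod (\<mu> ^ t * S a 0 \<sigma>))\<^sup>2"
proof -
  define m where "m = \<mu> ^ t * S a 0 \<sigma>"
  define K where "K = 16 * B ^ 4 * n"
  define A where "A = {\<tau>. cmod (S a t \<tau>) \<le> cmod m / 2}"
  let ?p = "ctr_law n \<sigma> t" and ?U = "pmf_of_set (sym_group n)"
  have m: "cmod m > 0" using assms norm_\<mu>_pos by (simp add: m_def)
  have "set_pmf ?p \<subseteq> sym_group n"
    using n assms by (intro set_ctr_law_subset) auto
  then have fin: "finite (set_pmf ?p)" "finite (set_pmf ?U)"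
    by (auto intro: finite_subset simp: set_pmf_of_set)
  note int = integrable_measure_pmf_finite[OF fin(1)] integrable_measure_pmf_finite[OF fin(2)]
  have "measure_pmf.prob ?p A = measure_pmf.expectation ?p (indicator A)" by simp
  also have "\<dots> \<le> measure_pmf.expectation ?p (\<lambda>\<tau>. (cmod (S a t \<tau> - m))\<^sup>2 * (4 / (cmod m)\<^sup>2))"
  proof (intro integral_mono int)
    fix \<tau>
    show "indicator A \<tau> \<le> (cmod (S a t \<tau> - m))\<^sup>2 * (4 / (cmod m)\<^sup>2)"
    proof (cases "\<tau> \<in> A")
      case True
      then have "cmod m / 2 \<le> cmod (S a t \<tau> - m)"
        using norm_triangle_ineq2[of m "S a t \<tau>"] by (simp add: A_def norm_minus_commute)
      then have "(cmod m / 2)\<^sup>2 \<le> (cmod (S a t \<tau> - m))\<^sup>2" by (intro power_mono) auto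
      then show ?thesis using True m by (simp add: field_simps power2_eq_square)
    qed simp
  qed
  also have "\<dots> = measure_pmf.expectation ?p (\<lambda>\<tau>. (cmod (S a t \<tau> - m))\<^sup>2) * (4 / (cmod m)\<^sup>2)"
    by simp
  also have "measure_pmf.expectation ?p (\<lambda>\<tau>. (cmod (S a t \<tau> - m))\<^sup>2) =
      measure_pmf.expectation ?p (\<lambda>\<tau>. (cmod (S a t \<tau>))\<^sup>2 - 2 * inner m (S a t \<tau>) + (cmod m)\<^sup>2)"
    by (simp add: power2_norm_eq_inner inner_diff inner_commute algebra_simps)
  also have "\<dots> = measure_pmf.expectation ?p (\<lambda>\<tau>. (cmod (S a t \<tau>))\<^sup>2) -
      2 * inner m (measure_pmf.expectation ?p (S a t)) + (cmod m)\<^sup>2"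
    by (simp add: int)
  \<comment> \<open>As m is the mean, the cross term turns the expansion into the second moment
    minus |m|^2.\<close>
  also have "\<dots> \<le> K"
    using second_moment_S_le[OF assms(1), of t] expectation_S[OF assms(1), of t a]
    by (simp add: m_def K_def power2_norm_eq_inner)
  finally have 1: "measure_pmf.prob ?p A \<le> K * (4 / (cmod m)\<^sup>2)"
    by (simp add: divide_right_mono)
  have "measure_pmf.prob ?U (- A) = measure_pmf.expectation ?U (indicator (- A))" by simp
  also have "\<dots> \<le> measure_pmf.expectation ?U (\<lambda>\<tau>. (cmod (S a t \<tau>))\<^sup>2 * (4 / (cmod m)\<^sup>2))"
  proof (intro integral_mono int)
    fix \<tau>
    show "indicator (- A) \<tau> \<le> (cmod (S a t \<tau>))\<^sup>2 * (4 / (cmod m)\<^sup>2)"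
    proof (cases "\<tau> \<in> A")
      case False
      then have "(cmod m / 2)\<^sup>2 \<le> (cmod (S a t \<tau>))\<^sup>2"
        by (intro power_mono) (auto simp: A_def)
      then show ?thesis using False m by (simp add: field_simps power2_eq_square)
    qed simp
  qed
  also have "\<dots> = measure_pmf.expectation ?U (\<lambda>\<tau>. (cmod (S a t \<tau>))\<^sup>2) * (4 / (cmod m)\<^sup>2)"
    by (rule integral_mult_left_zero)
  also have "\<dots> \<le> K * (4 / (cmod m)\<^sup>2)"
    unfolding K_def by (intro mult_right_mono uniform_second_moment_S_le) auto
  finally have "1 - measure_pmf.prob ?U A \<le> K * (4 / (cmod m)\<^sup>2)"
    using measure_pmf.prob_compl[of A ?U] by (simp add: Compl_eq_Diff_UNIV)
  with 1 tv_dist_ge[of ?p A ?U] have "1 - 2 * (K * (4 / (cmod m)\<^sup>2)) \<le> tv_dist ?p ?U"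
    by linarith
  then show ?thesis by (simp add: K_def m_def)
qed

end

text \<open>Because the powers of \<beta> sum to n, the expanded squares give the sum of |\<beta>| ^
  (2 k) minus n. Pairing k with n - 1 - k, the arithmetic-geometric mean inequality makes each pair
  at least 2 |\<beta>| ^ (n - 1) >= 4.\<close>

lemma sum_norm_sq_g_ge: "(\<Sum>p<n. (cmod (g t p))\<^sup>2) \<ge> n"
proof -
  define \<rho> where "\<rho> = cmod \<beta>"
  have \<rho>: "\<rho> \<ge> 1" using norm_\<beta>_ge by (simp add: \<rho>_def)
  have "(\<Sum>p<n. (cmod (g t p))\<^sup>2) = (\<Sum>k<n. (cmod (\<beta> ^ k - 1))\<^sup>2)"
    unfolding g_def by (rule sum_wait)
  also have "\<dots> = (\<Sum>k<n. \<rho> ^ (2 * k) - 2 * Re (\<beta> ^ k) + 1)"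
  proof (intro sum.cong refl)
    fix k
    have "(cmod (w - 1))\<^sup>2 = (cmod w)\<^sup>2 - 2 * Re w + 1" for w
      unfolding cmod_power2 by (simp add: power2_eq_square algebra_simps)
    then show "(cmod (\<beta> ^ k - 1))\<^sup>2 = \<rho> ^ (2 * k) - 2 * Re (\<beta> ^ k) + 1"
      by (simp add: \<rho>_def norm_power mult.commute flip: power_mult)
  qed
  also have "\<dots> = (\<Sum>k<n. \<rho> ^ (2 * k)) - 2 * Re (\<Sum>k<n. \<beta> ^ k) + n"
    by (simp add: sum.distrib sum_subtractf sum_distrib_left)
  also have "\<dots> = (\<Sum>k<n. \<rho> ^ (2 * k)) - n"
    by (simp add: sum_\<beta>_power)
  finally have eq: "(\<Sum>p<n. (cmod (g t p))\<^sup>2) = (\<Sum>k<n. \<rho> ^ (2 * k)) - n" .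
  have "2 * (\<Sum>k<n. \<rho> ^ (2 * k)) = (\<Sum>k<n. \<rho> ^ (2 * k) + \<rho> ^ (2 * (n - Suc k)))"
    by (simp add: sum.distrib sum.nat_diff_reindex[of "\<lambda>k. \<rho> ^ (2 * k)"])
  also have "\<dots> \<ge> (\<Sum>k<n. 4)"
  proof (intro sum_mono)
    fix k assume k: "k \<in> {..<n}"
    have "4 \<le> \<rho> ^ n" using large by (simp add: \<rho>_def \<beta>_power flip: norm_power)
    also have "\<dots> \<le> \<rho> ^ (2 * (n - 1))"
      using n by (intro power_increasing \<rho>) auto
    finally have "2\<^sup>2 \<le> (\<rho> ^ (n - 1))\<^sup>2" by (simp add: mult.commute flip: power_mult)
    then have "2 \<le> \<rho> ^ (n - 1)" by (rule power2_le_imp_le) (use \<rho> in simp)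
    also have "\<rho> ^ (n - 1) = \<rho> ^ k * \<rho> ^ (n - Suc k)"
      using k by (simp flip: power_add)
    finally have "4 \<le> 2 * (\<rho> ^ k * \<rho> ^ (n - Suc k))" by simp
    also have "\<dots> \<le> (\<rho> ^ k)\<^sup>2 + (\<rho> ^ (n - Suc k))\<^sup>2"
      using sum_squares_bound[of "\<rho> ^ k" "\<rho> ^ (n - Suc k)"] by simp
    finally show "4 \<le> \<rho> ^ (2 * k) + \<rho> ^ (2 * (n - Suc k))"
      by (simp add: mult.commute flip: power_mult)
  qed
  finally show ?thesis using eq by simp
qed

lemma tv_dist_ctr_law_ge:
  "tv_dist (ctr_law n id t) (pmf_of_set (sym_group n)) \<ge>
    1 - 128 * (1 + cmod (1 + z)) ^ 4 / (n * cmod \<mu> ^ (2 * t))"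
proof -
  \<comment> \<open>From the identity, card c starts at location c, so these weights align all
    phases and every term is a squared modulus.\<close>
  define a where "a = (\<lambda>c. cnj (g 0 c))"
  define B where "B = 1 + cmod (1 + z)"
  have "S a 0 id = complex_of_real (\<Sum>p<n. (cmod (g 0 p))\<^sup>2)"
    by (simp add: S_def a_def complex_norm_square mult.commute del: of_real_power)
  then have S0: "cmod (S a 0 id) = (\<Sum>p<n. (cmod (g 0 p))\<^sup>2)"
    by (simp only: norm_of_real) (simp add: sum_nonneg)
  then have ge: "cmod (S a 0 id) \<ge> n"
    using sum_norm_sq_g_ge by simp
  then have "S a 0 id \<noteq> 0" using n by auto
  have le: "(n * cmod \<mu> ^ t)\<^sup>2 \<le> (cmod (\<mu> ^ t * S a 0 id))\<^sup>2"
    unfolding norm_mult norm_power using ge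
    by (intro power_mono) (auto simp: mult.commute[of "real n"] intro!: mult_left_mono)
  have pos: "(n * cmod \<mu> ^ t)\<^sup>2 > 0" using n norm_\<mu>_pos by simp
  have "128 * B ^ 4 * n / (cmod (\<mu> ^ t * S a 0 id))\<^sup>2 \<le> 128 * B ^ 4 * n / (n * cmod \<mu> ^ t)\<^sup>2"
    by (rule divide_left_mono[OF le _ mult_pos_pos[OF less_le_trans[OF pos le] pos]]) simp
  also have "(n * cmod \<mu> ^ t)\<^sup>2 = n * (n * cmod \<mu> ^ (2 * t))"
    by (simp add: power2_eq_square mult_2 power_add)
  also have "128 * B ^ 4 * n / (n * (n * cmod \<mu> ^ (2 * t))) = 128 * B ^ 4 / (n * cmod \<mu> ^ (2 * t))"
    using n by simp
  finally have "128 * B ^ 4 * n / (cmod (\<mu> ^ t * S a 0 id))\<^sup>2 \<le> 128 * B ^ 4 / (n * cmod \<mu> ^ (2 * t))" .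
  moreover have "cmod (a c) \<le> B" for c by (simp add: a_def B_def norm_g_le)
  note tv_dist_ge_moments[OF this B_def id_in_sym_group \<open>S a 0 id \<noteq> 0\<close>, of t]
  ultimately show ?thesis unfolding B_def by linarith
qed

end

section \<open>The lower bound on the mixing time\<close>

text \<open>With d = - ln |\<mu>|, one cycle costs n d = ln |1 + z| - n ln (1 - 1/n), which is at
  most c. The time considered amounts to at most ln n / s cycles.\<close>

lemma (in ctr_eigen) inverse_norm_\<mu>_power_le:
  assumes s: "s > 0" and t: "real t \<le> n * ln n / s"
    and c: "ln (cmod (1 + z)) + n / (real n - 1) \<le> c"
  shows "1 / cmod \<mu> ^ (2 * t) \<le> exp (2 * c / s * ln n)"
proof -
  define d where "d = ln (cmod \<beta>) - ln (1 - 1 / real n)"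
  have b: "cmod \<beta> > 0" using \<beta>_nonzero by simp
  have n1: "1 - 1 / real n > 0" using n by simp
  have "ln (cmod (1 + z)) = n * ln (cmod \<beta>)"
    using b by (simp add: ln_realpow norm_power flip: \<beta>_power)
  moreover have "- ln (1 - 1 / real n) = ln (1 + 1 / (real n - 1))"
    using n by (subst ln_inverse[symmetric]) (auto simp: field_simps)
  then have "d = ln (cmod \<beta>) + ln (1 + 1 / (real n - 1))"
    by (simp add: d_def)
  moreover have "ln (1 + 1 / (real n - 1)) \<le> 1 / (real n - 1)"
    using n by (intro ln_add_one_self_le_self) auto
  then have "n * ln (1 + 1 / (real n - 1)) \<le> n / (real n - 1)"
    using n mult_left_mono by fastforce
  ultimately have nd: "n * d \<le> c"
    using c by (simp add: algebra_simps)
  have "ln (cmod \<beta>) \<ge> 0" using norm_\<beta>_ge by simp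
  moreover have "ln (1 - 1 / real n) \<le> 0" using n by simp
  ultimately have "d \<ge> 0" by (simp add: d_def)
  have "cmod \<mu> = exp (- d)"
    using b n1 by (simp add: norm_\<mu> d_def exp_diff)
  then have "1 / cmod \<mu> ^ (2 * t) = exp (2 * (real t * d))"
    by (simp add: exp_minus divide_inverse flip: exp_of_nat_mult power_inverse)
  also have "real t * d \<le> n * ln n / s * d"
    using t \<open>d \<ge> 0\<close> by (rule mult_right_mono)
  also have "n * ln n / s * d = (n * d) * (ln n / s)" by simp
  also have "\<dots> \<le> c * (ln n / s)"
    using nd s n by (intro mult_right_mono) auto
  finally show ?thesis by (simp add: mult.assoc)
qed

lemma mixing_time_ge_of_root:
  fixes \<zeta> :: complex
  assumes \<zeta>: "exp \<zeta> = \<zeta> + 1" "\<zeta> \<noteq> 0"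
  shows "\<forall>\<^sub>F n in sequentially. real (mixing_time n) \<ge> real n * ln (real n) / cmod (\<zeta> + 1)"
proof -
  define s where "s = cmod (\<zeta> + 1)"
  have s: "s > 6" unfolding s_def by (rule exp_eq_plus_one_norm_gt[OF \<zeta>])
  \<comment> \<open>The midpoint of 1 + ln (s + 1/4) and s / 2: the lower half of the gap absorbs n
    / (n - 1) - 1 for large n, the upper half gives 2 c / s < 1.\<close>
  define c where "c = (1 + ln (s + 1/4) + s / 2) / 2"
  (* Over n ln n / s steps the mean decays by the factor n ^ (- (1 + ln s) / s); an exponent strictly
     below 1/2 still dominates the fluctuations and leaves the slack that allows epsilon = 0. *)
  have lt: "1 + ln (s + 1/4) < s / 2"
  proof -
    \<comment> \<open>The tangent of ln is taken at 25/4, the value of s + 1/4 at s = 6. With ln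
      (25/4) <= 2 the claim reduces to 0.34 s > 2.04, that is, exactly s > 6.\<close>
    have "ln ((s + 1/4) / (25/4)) \<le> (s + 1/4) / (25/4) - 1"
      using s by (intro ln_le_minus_one) auto
    moreover have "ln ((s + 1/4) / (25/4)) = ln (s + 1/4) - ln (25/4)"
      using s by (intro ln_divide_pos) auto
    moreover have "ln (25/4 :: real) \<le> 2"
    proof -
      have "(25/4 :: real) = (5/2)\<^sup>2" by (simp add: power2_eq_square)
      also have "\<dots> \<le> (exp 1)\<^sup>2"
        using exp_lower_Taylor_quadratic[of 1] by (intro power_mono) auto
      also have "\<dots> = exp 2" by (simp flip: exp_double)
      finally show ?thesis using ln_mono[of "25/4" "exp 2"] by simp
    qed
    ultimately show ?thesis using s by (simp add: field_simps)
  qed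
  \<comment> \<open>Up to time n ln n / s the Chebyshev error is at most C n ^ \<kappa>. The
    constant C arises from 1 + |1 + z| <= s + 5/4 on the ball of radius 1/4.\<close>
  define \<kappa> where "\<kappa> = 2 * c / s - 1"
  have "\<kappa> < 0" using lt s by (simp add: \<kappa>_def c_def field_simps)
  define C where "C = 128 * (s + 5/4) ^ 4"
  have ev1: "\<forall>\<^sub>F n in sequentially. \<exists>z\<in>ball \<zeta> (1/4). (1 + z / of_nat n) ^ n = 1 + z"
    by (rule eventually_root_near[OF \<zeta>(1)]) simp
  have "(\<lambda>n. real n / (real n - 1)) \<longlonglongrightarrow> 1" by real_asymp
  then have ev2: "\<forall>\<^sub>F n in sequentially. real n / (real n - 1) < c - ln (s + 1/4)"
    by (rule order_tendstoD) (use lt in \<open>simp add: c_def field_simps\<close>)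
  have "(\<lambda>n. C * exp (\<kappa> * ln (real n))) \<longlonglongrightarrow> 0"
    using \<open>\<kappa> < 0\<close> by real_asymp
  then have ev3: "\<forall>\<^sub>F n in sequentially. C * exp (\<kappa> * ln (real n)) < 1/2"
    by (rule order_tendstoD) simp
  show ?thesis
    using ev1 ev2 ev3 eventually_gt_at_top[of 1]
  proof eventually_elim
    case (elim n)
    then obtain z where z: "z \<in> ball \<zeta> (1/4)" "(1 + z / of_nat n) ^ n = 1 + z" by blast
    have "cmod ((1 + z) - (\<zeta> + 1)) < 1/4"
      using z(1) by (simp add: dist_norm norm_minus_commute)
    then have z_le: "cmod (1 + z) \<le> s + 1/4" and z_ge: "cmod (1 + z) \<ge> 4"
      using norm_triangle_ineq3[of "1 + z" "\<zeta> + 1"] s by (auto simp: s_def)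
    interpret ctr_eigen n z
      by unfold_locales (use elim z z_ge in auto)
    show ?case
      unfolding s_def[symmetric]
    proof (rule mixing_time_ge[where \<sigma> = id])
      fix t assume "real t < n * ln n / s"
      then have t: "real t \<le> n * ln n / s" by simp
      have "ln (cmod (1 + z)) \<le> ln (s + 1/4)" using z_le z_ge by (intro ln_mono) auto
      then have "1 / cmod \<mu> ^ (2 * t) \<le> exp (2 * c / s * ln n)"
        using s elim by (intro inverse_norm_\<mu>_power_le t) auto
      then have "128 * (1 + cmod (1 + z)) ^ 4 * (1 / cmod \<mu> ^ (2 * t)) / n \<le> C * exp (2 * c / s * ln n) / n"
        unfolding C_def using z_le
        by (intro divide_right_mono mult_mono power_mono) auto
      also have "\<dots> = C * exp (\<kappa> * ln n)"
        using elim by (simp add: \<kappa>_def left_diff_distrib exp_diff)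
      finally have "128 * (1 + cmod (1 + z)) ^ 4 / (n * cmod \<mu> ^ (2 * t)) < 1/2"
        using elim by (simp add: mult.commute)
      then have "1/2 < tv_dist (ctr_law n id t) (pmf_of_set (sym_group n))"
        using tv_dist_ctr_law_ge[of t] by linarith
      moreover have "1 / (2 * exp 1) \<le> (1/2 :: real)"
        using exp_ge_add_one_self[of "1::real"] by (simp add: field_simps)
      ultimately show "1 / (2 * exp 1) < tv_dist (ctr_law n id t) (pmf_of_set (sym_group n))"
        by (rule le_less_trans[rotated])
    qed (use elim in auto)
  qed
qed

theorem theorem1p1:
  shows "(\<lambda>n. real (mixing_time n)) \<in> \<Omega>(\<lambda>n. real n * ln (real n)) \<and>
    (\<forall>\<zeta>::complex. \<zeta> \<noteq> 0 \<and> exp \<zeta> - \<zeta> - 1 = 0 \<longrightarrow>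
       (\<exists>\<epsilon>::nat \<Rightarrow> real. \<epsilon> \<in> o(\<lambda>_. 1) \<and>
          (\<forall>\<^sub>F n in sequentially.
             real (mixing_time n) \<ge> real n * ln (real n) / (cmod (\<zeta> + 1) * (1 + \<epsilon> n)))))"
proof (intro conjI allI impI)
  \<comment> \<open>Any single nonzero root supplies the constant 1 / |\<zeta> + 1| for the growth
    rate.\<close>
  obtain \<zeta> :: complex where \<zeta>: "exp \<zeta> = \<zeta> + 1" "\<zeta> \<noteq> 0"
    using exp_eq_plus_one_exists by blast
  have "\<forall>\<^sub>F n in sequentially. norm (real (mixing_time n)) \<ge> 1 / cmod (\<zeta> + 1) * norm (real n * ln (real n))"
    using mixing_time_ge_of_root[OF \<zeta>] eventually_gt_at_top[of 0]
    by eventually_elim (simp add: abs_mult)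
  moreover have "1 / cmod (\<zeta> + 1) > 0"
    using exp_eq_plus_one_norm_gt[OF \<zeta>] by (intro divide_pos_pos) linarith+
  ultimately show "(\<lambda>n. real (mixing_time n)) \<in> \<Omega>(\<lambda>n. real n * ln (real n))"
    by (rule landau_omega.bigI[rotated])
next
  fix \<zeta> :: complex assume "\<zeta> \<noteq> 0 \<and> exp \<zeta> - \<zeta> - 1 = 0"
  then have "exp \<zeta> = \<zeta> + 1" "\<zeta> \<noteq> 0" by (auto simp: algebra_simps)
  from mixing_time_ge_of_root[OF this]
  show "\<exists>\<epsilon>::nat \<Rightarrow> real. \<epsilon> \<in> o(\<lambda>_. 1) \<and> (\<forall>\<^sub>F n in sequentially.
      real (mixing_time n) \<ge> real n * ln (real n) / (cmod (\<zeta> + 1) * (1 + \<epsilon> n)))"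
    \<comment> \<open>The strict slack in the exponent already absorbed all lower-order errors, so
      the zero error term works.\<close>
    by (intro exI[of _ "\<lambda>_. 0"]) simp
qed

end
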